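(* Let $G$ be an infinite countable discrete group, let $1\le p<\infty$, let $S\subset G$ be any subset, and let $\omega$ be an $S$-admissible weight on $G$. There is an $S$-dense vector in $L^p(G,\omega)$ if and only if for every increasing sequence $(F_n)_{n\ge1}$ of finite subsets of $G$ there exists a sequence $(s_n)_{n\ge1}\subset S$ such that the sets $s_n^{-1}F_n$ ($n\ge1$) are pairwise disjoint and, setting $s_0=e$, $F_0=\emptyset$, $$\sum_{n,k\ge0:\ n\ne k}\ \int_{s_ns_k^{-1}F_k}\omega^p\,d\mu<\infty .$$
   Context: $G$ has identity $e$ and Haar measure $\mu$, which for discrete $G$ is (a multiple of) counting measure, so $\int_A\omega^p\,d\mu$ is (up to a constant) $\sum_{t\in A}\omega(t)^p$. A weight on $G$ is a strictly positive function $\omega$ on $G$. $L^p(G,\omega)$ is the space of complex-valued functions $f$ on $G$ with $\|f\|_{p,\omega}=\big(\int_G|f\omega|^p\,d\mu\big)^{1/p}<\infty$. For $s\in G$, $(T_sf)(t)=f(s^{-1}t)$. A weight $\omega$ is $S$-admissible if for each $s\in S$ the operator $T_s$ is bounded on $L^p(G,\omega)$; equivalently $\sup_{t\in G}\omega(st)/\omega(t)<\infty$ for all $s\in S$. A vector $f\in L^p(G,\omega)$ is $S$-dense if $\{T_sf:s\in S\}$ is dense in $L^p(G,\omega)$. "Increasing" means $F_n\subset F_{n+1}$. *)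

theory Defs
  imports "HOL-Analysis.Analysis" "HOL-Algebra.Coset"
begin

text \<open>
  Haar measures on a countable discrete group: every subset is Borel, the compact sets are the
  finite ones, and regularity is automatic.
\<close>
definition discrete_haar_measure :: "('a, 'b) monoid_scheme \<Rightarrow> 'a measure \<Rightarrow> bool" where
  "discrete_haar_measure G \<mu> \<longleftrightarrow>
     space \<mu> = carrier G \<and> sets \<mu> = Pow (carrier G) \<and>
     (\<forall>s\<in>carrier G. \<forall>A. A \<subseteq> carrier G \<longrightarrow> emeasure \<mu> (s <#\<^bsub>G\<^esub> A) = emeasure \<mu> A) \<and>
     (\<forall>A. A \<subseteq> carrier G \<longrightarrow> finite A \<longrightarrow> emeasure \<mu> A < \<infinity>) \<and>
     emeasure \<mu> (carrier G) \<noteq> 0"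

definition weight_on :: "('a, 'b) monoid_scheme \<Rightarrow> ('a \<Rightarrow> real) \<Rightarrow> bool" where
  "weight_on G \<omega> \<longleftrightarrow> (\<forall>t\<in>carrier G. \<omega> t > 0)"

text \<open>
  Functions on the underlying set are represented as extensional functions, so that two elements
  of the space are equal iff they agree on \<^term>\<open>space \<mu>\<close>. No quotient by null functions is taken:
  Haar measure on a discrete group has no nonempty null sets.
\<close>
definition weighted_Lp :: "'a measure \<Rightarrow> real \<Rightarrow> ('a \<Rightarrow> real) \<Rightarrow> ('a \<Rightarrow> complex) set" where
  "weighted_Lp \<mu> p \<omega> =
     {f \<in> extensional (space \<mu>). f \<in> borel_measurable \<mu> \<and>
        (\<integral>\<^sup>+t. ennreal (norm (f t * of_real (\<omega> t)) powr p) \<partial>\<mu>) < \<infinity>}"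

definition weighted_Lp_norm :: "'a measure \<Rightarrow> real \<Rightarrow> ('a \<Rightarrow> real) \<Rightarrow> ('a \<Rightarrow> complex) \<Rightarrow> real" where
  "weighted_Lp_norm \<mu> p \<omega> f =
     enn2real (\<integral>\<^sup>+t. ennreal (norm (f t * of_real (\<omega> t)) powr p) \<partial>\<mu>) powr (1 / p)"

definition left_translation ::
    "('a, 'b) monoid_scheme \<Rightarrow> 'a \<Rightarrow> ('a \<Rightarrow> complex) \<Rightarrow> 'a \<Rightarrow> complex" where
  "left_translation G s f = (\<lambda>t\<in>carrier G. f (inv\<^bsub>G\<^esub> s \<otimes>\<^bsub>G\<^esub> t))"

definition admissible_weight ::
    "('a, 'b) monoid_scheme \<Rightarrow> 'a measure \<Rightarrow> real \<Rightarrow> 'a set \<Rightarrow> ('a \<Rightarrow> real) \<Rightarrow> bool" where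
  "admissible_weight G \<mu> p S \<omega> \<longleftrightarrow>
     weight_on G \<omega> \<and>
     (\<forall>s\<in>S. \<exists>C. \<forall>f\<in>weighted_Lp \<mu> p \<omega>.
        left_translation G s f \<in> weighted_Lp \<mu> p \<omega> \<and>
        weighted_Lp_norm \<mu> p \<omega> (left_translation G s f) \<le> C * weighted_Lp_norm \<mu> p \<omega> f)"

definition dense_vector ::
    "('a, 'b) monoid_scheme \<Rightarrow> 'a measure \<Rightarrow> real \<Rightarrow> 'a set \<Rightarrow> ('a \<Rightarrow> real) \<Rightarrow> ('a \<Rightarrow> complex) \<Rightarrow> bool"
  where
  "dense_vector G \<mu> p S \<omega> f \<longleftrightarrow>
     f \<in> weighted_Lp \<mu> p \<omega> \<and>
     (\<forall>g\<in>weighted_Lp \<mu> p \<omega>. \<forall>\<epsilon>>0. \<exists>s\<in>S.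
        weighted_Lp_norm \<mu> p \<omega> (\<lambda>t. left_translation G s f t - g t) < \<epsilon>)"

end

theory Submission
  imports Defs
begin

text \<open>
  Write \<open>N(h)\<close> for the integral of \<open>|h \<omega>|\<^sup>p\<close> and \<open>m(A)\<close> for the integral of \<open>\<omega>\<^sup>p\<close> over \<open>A\<close>; in the
  code these are \<open>modular h\<close> and \<open>mass A\<close>. Closeness in norm is the same as smallness of \<open>N\<close> of the
  difference. All estimates rest on two comparisons: if \<open>|h| \<ge> K\<close> on \<open>A\<close>, then \<open>K\<^sup>p m(A) \<le> N(h)\<close>;
  and if \<open>h\<close> is dominated by \<open>M\<^sub>i\<close> on sets \<open>A\<^sub>i\<close> covering its support, then \<open>N(h)\<close> is at most the
  sum of the numbers \<open>M\<^sub>i\<^sup>p m(A\<^sub>i)\<close>.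

  From a dense vector \<open>f\<close> to packings: let \<open>s \<in> S\<close> be such that \<open>T\<^sub>s f\<close> is very close to the function
  with value \<open>2K\<close> on a finite set \<open>F\<close> and \<open>0\<close> elsewhere. Then \<open>|f| \<ge> K\<close> on \<open>s\<^sup>-\<^sup>1 F\<close>. For large \<open>K\<close> this
  makes \<open>m(s\<^sup>-\<^sup>1F)\<close> small, hence by boundedness of translations also \<open>m(r s\<^sup>-\<^sup>1F)\<close> for finitely many
  prescribed \<open>r\<close>, and it keeps \<open>s\<^sup>-\<^sup>1 F\<close> away from any finite set \<open>B\<close>. Moreover, if \<open>|f| \<ge> 1\<close> on \<open>B\<close>,
  then \<open>T\<^sub>s f\<close> has modulus at least \<open>1\<close> on \<open>sB\<close>, which is disjoint from \<open>F\<close>, so \<open>m(sB)\<close> is bounded by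
  the approximation error. Choosing \<open>s\<^sub>n\<close> recursively in this way, with \<open>B\<close> the union of the sets
  \<open>s\<^sub>k\<^sup>-\<^sup>1F\<^sub>k\<close> already placed, makes every entry of the double series with indices \<open>n\<close> and \<open>k\<close> at
  most \<open>4\<close> to the power \<open>- max n k\<close>. The step is \<open>dense_vector_step\<close>.

  From packings to a dense vector: enumerate a countable dense set of finitely supported functions as
  \<open>g\<^sub>0, g\<^sub>1, \<dots>\<close>, each of them infinitely often, and apply the hypothesis to finite sets \<open>F\<^sub>n\<close>
  containing the supports of \<open>g\<^sub>i\<close> for \<open>i < n\<close>. The column sums of the double series tend to \<open>0\<close>, so
  there are indices \<open>k\<^sub>0 < k\<^sub>1 < \<dots>\<close> growing so fast that the series still converges after its columns
  \<open>k\<^sub>i\<close> have been multiplied by the bounds \<open>M\<^sub>i\<^sup>p\<close> of \<open>|g\<^sub>i|\<^sup>p\<close>. Place a copy of \<open>g\<^sub>i\<close>, translated by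
  the inverse of \<open>s\<^sub>k\<close> with \<open>k = k\<^sub>i\<close>, on each set \<open>s\<^sub>k\<^sup>-\<^sup>1F\<^sub>k\<close>, and let \<open>f\<close> be the sum of these copies.
  Row \<open>0\<close> of the series shows that \<open>f\<close> is in the space, and the other rows bound the distance between
  \<open>g\<^sub>j\<close> and the translate of \<open>f\<close> that puts the copy of \<open>g\<^sub>j\<close> back into place. These distances tend
  to \<open>0\<close> because the series of row sums converges (\<open>summable_packings_imp_approximating_orbit\<close>).
\<close>

section \<open>Series of extended nonnegative reals\<close>


text \<open>
  Both sides are suprema of finite partial sums, and the pairing bijection of the naturals makes the
  finite subsets of the index plane cofinal with its initial segments.
\<close>
lemma infsum_ennreal_eq_double_suminf:
  fixes u :: "nat \<times> nat \<Rightarrow> ennreal"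
  shows "infsum u UNIV = (\<Sum>n. \<Sum>k. u (n, k))"
proof -
  have "infsum u UNIV = (\<Sum>i. u (prod_decode i))"
  proof (rule antisym)
    show "infsum u UNIV \<le> (\<Sum>i. u (prod_decode i))"
      unfolding nonneg_infsum_complete[of UNIV u, simplified]
    proof (rule SUP_least)
      fix F :: "(nat \<times> nat) set" assume "F \<in> {F. finite F}"
      then have F: "finite F" by simp
      have "sum u F = sum (u \<circ> prod_decode) (prod_encode ` F)"
        by (subst sum.reindex) (auto simp: inj_on_def)
      also have "\<dots> \<le> (\<Sum>i. u (prod_decode i))"
        unfolding comp_def by (rule sum_le_suminf) (use F in auto)
      finally show "sum u F \<le> (\<Sum>i. u (prod_decode i))" .
    qed
    show "(\<Sum>i. u (prod_decode i)) \<le> infsum u UNIV"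
    proof (rule suminf_le_const)
      fix N
      have "(\<Sum>i<N. u (prod_decode i)) = sum u (prod_decode ` {..<N})"
        by (subst sum.reindex) (auto simp: inj_on_def)
      also have "\<dots> \<le> infsum u UNIV"
        unfolding nonneg_infsum_complete[of UNIV u, simplified]
        by (rule SUP_upper) auto
      finally show "(\<Sum>i<N. u (prod_decode i)) \<le> infsum u UNIV" .
    qed simp
  qed
  also have "\<dots> = (\<Sum>n. \<Sum>k. u (n, k))"
    by (rule suminf_ennreal_2dimen) simp
  finally show ?thesis .
qed

text \<open>
  The unordered sum over all pairs is invariant under exchanging the coordinates.
\<close>
lemma double_suminf_ennreal_swap:
  fixes u :: "nat \<Rightarrow> nat \<Rightarrow> ennreal"
  shows "(\<Sum>n. \<Sum>k. u n k) = (\<Sum>k. \<Sum>n. u n k)"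
proof -
  have "infsum (\<lambda>(n, k). u n k) (prod.swap ` UNIV) = infsum ((\<lambda>(n, k). u n k) \<circ> prod.swap) UNIV"
    by (rule infsum_reindex) simp
  also have "(\<lambda>(n, k). u n k) \<circ> prod.swap = (\<lambda>(k, n). u n k)" by auto
  finally show ?thesis
    by (simp add: infsum_ennreal_eq_double_suminf)
qed

lemma suminf_ennreal_subseq_le:
  fixes u :: "nat \<Rightarrow> ennreal"
  assumes "inj k"
  shows "(\<Sum>j. u (k j)) \<le> (\<Sum>n. u n)"
proof (rule suminf_le_const)
  fix N
  have "(\<Sum>j<N. u (k j)) = sum u (k ` {..<N})"
    using assms by (subst sum.reindex) (auto intro: inj_on_subset)
  also have "\<dots> \<le> (\<Sum>n. u n)" by (rule sum_le_suminf) auto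
  finally show "(\<Sum>j<N. u (k j)) \<le> (\<Sum>n. u n)" .
qed simp

lemma suminf_ennreal_finite_imp_LIMSEQ_zero:
  fixes u :: "nat \<Rightarrow> ennreal"
  assumes "(\<Sum>n. u n) < \<infinity>"
  shows "u \<longlonglongrightarrow> 0"
proof -
  have fin: "u n \<noteq> \<infinity>" for n
    using ennreal_suminf_lessD[OF assms, of n] by simp
  have "(\<Sum>n. ennreal (enn2real (u n))) = (\<Sum>n. u n)"
    using fin by (simp add: ennreal_enn2real_if)
  then have "summable (\<lambda>n. enn2real (u n))"
    using assms by (intro summable_suminf_not_top) auto
  then have "(\<lambda>n. enn2real (u n)) \<longlonglongrightarrow> 0" by (rule summable_LIMSEQ_zero)
  then have "(\<lambda>n. ennreal (enn2real (u n))) \<longlonglongrightarrow> ennreal 0" by (rule tendsto_ennrealI)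
  then show ?thesis using fin by (simp add: ennreal_enn2real_if)
qed

lemma suminf_ennreal_half_power: "(\<Sum>n. ennreal ((1/2) ^ n)) = 2"
proof -
  have "(\<lambda>n. (1/2 :: real) ^ n) sums 2"
    using geometric_sums[of "1/2 :: real"] by simp
  then have "(\<Sum>n. ennreal ((1/2) ^ n)) = ennreal 2"
    by (rule suminf_ennreal_eq[rotated]) (rule zero_le_power, simp)
  also have "\<dots> = 2" by (rule ennreal_numeral)
  finally show ?thesis .
qed

lemma infsum_off_diagonal:
  fixes a :: "nat \<Rightarrow> nat \<Rightarrow> ennreal"
  shows "(\<Sum>\<^sub>\<infinity>(n, k)\<in>{(n, k). n \<noteq> k}. a n k) = (\<Sum>n. \<Sum>k. if n = k then 0 else a n k)"
proof -
  have "(\<Sum>\<^sub>\<infinity>(n, k)\<in>{(n, k). n \<noteq> k}. a n k) =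
      infsum (\<lambda>(n, k). if n = k then 0 else a n k) UNIV"
    by (rule infsum_cong_neutral) auto
  then show ?thesis by (simp add: infsum_ennreal_eq_double_suminf)
qed

text \<open>
  The weights \<open>c\<close> are arbitrary, however fast they grow: each is fixed before the index at which
  \<open>b\<close> has to beat it is chosen.
\<close>
lemma sparse_subsequence:
  fixes b :: "nat \<Rightarrow> ennreal" and c :: "nat \<Rightarrow> real"
  assumes "b \<longlonglongrightarrow> 0"
  obtains k :: "nat \<Rightarrow> nat" where "strict_mono k" "\<And>i. i < k i"
    "\<And>i. ennreal (c i) * b (k i) \<le> ennreal ((1/2) ^ i)"
proof -
  have ex: "\<exists>k>m. ennreal (c i) * b k \<le> ennreal ((1/2) ^ i)" for i m
  proof -
    have "(\<lambda>k. ennreal (c i) * b k) \<longlonglongrightarrow> ennreal (c i) * 0"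
      by (intro ennreal_tendsto_cmult assms) simp
    then have "\<forall>\<^sub>F k in sequentially. ennreal (c i) * b k < ennreal ((1/2) ^ i)"
      by (intro order_tendstoD(2)) auto
    then have "\<forall>\<^sub>F k in sequentially. ennreal (c i) * b k < ennreal ((1/2) ^ i) \<and> m < k"
      using eventually_gt_at_top[of m] by eventually_elim simp
    then show ?thesis unfolding eventually_sequentially by (meson less_imp_le order_refl)
  qed
  have "\<exists>k. \<forall>i. (i < k i \<and> ennreal (c i) * b (k i) \<le> ennreal ((1/2) ^ i)) \<and> k i < k (Suc i)"
  proof (rule dependent_nat_choice)
    show "\<exists>k. 0 < k \<and> ennreal (c 0) * b k \<le> ennreal ((1/2) ^ 0)" by (rule ex)
    fix k i :: nat
    obtain l where "l > max k (Suc i)" "ennreal (c (Suc i)) * b l \<le> ennreal ((1/2) ^ Suc i)"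
      using ex by blast
    then show "\<exists>l. (Suc i < l \<and> ennreal (c (Suc i)) * b l \<le> ennreal ((1/2) ^ Suc i)) \<and> k < l"
      by (intro exI[of _ l]) auto
  qed
  then show thesis using that by (auto simp: strict_mono_Suc_iff)
qed

section \<open>Weighted modulars on a countable discrete group\<close>

locale weighted_discrete_group = group G for G :: "('a, 'b) monoid_scheme" (structure) +
  fixes \<mu> :: "'a measure" and p :: real and \<omega> :: "'a \<Rightarrow> real"
  assumes countable_carrier: "countable (carrier G)"
    and haar: "discrete_haar_measure G \<mu>"
    and p_ge_1: "1 \<le> p"
    and weight: "weight_on G \<omega>"
begin

text \<open>
  The \<open>p\<close>-th power of the weighted norm, with value infinity outside the space. Unlike
  \<open>weighted_Lp_norm\<close>, which is \<open>0\<close> when the integral diverges, it is monotone in the modulus of the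
  function without any integrability assumption.
\<close>
definition modular :: "('a \<Rightarrow> complex) \<Rightarrow> ennreal" where
  "modular h = (\<integral>\<^sup>+t. ennreal (norm (h t * of_real (\<omega> t)) powr p) \<partial>\<mu>)"

definition mass :: "'a set \<Rightarrow> ennreal" where
  "mass A = (\<integral>\<^sup>+t\<in>A. ennreal (\<omega> t powr p) \<partial>\<mu>)"

lemma space_haar: "space \<mu> = carrier G" and sets_haar: "sets \<mu> = Pow (carrier G)"
  and haar_invariant: "s \<in> carrier G \<Longrightarrow> A \<subseteq> carrier G \<Longrightarrow> emeasure \<mu> (s <# A) = emeasure \<mu> A"
  and haar_finite: "A \<subseteq> carrier G \<Longrightarrow> finite A \<Longrightarrow> emeasure \<mu> A < \<infinity>"
  and haar_nonzero: "emeasure \<mu> (carrier G) \<noteq> 0"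
  using haar unfolding discrete_haar_measure_def by auto

lemma haar_measurable: "(h :: 'a \<Rightarrow> 'c :: topological_space) \<in> borel_measurable \<mu>"
  by (auto simp: measurable_def space_haar sets_haar)

lemma weight_pos: "t \<in> carrier G \<Longrightarrow> 0 < \<omega> t"
  using weight by (auto simp: weight_on_def)

lemma l_coset_mem_iff:
  assumes "s \<in> carrier G" "t \<in> carrier G" "E \<subseteq> carrier G"
  shows "t \<in> s <# E \<longleftrightarrow> inv s \<otimes> t \<in> E"
proof
  assume "t \<in> s <# E"
  then show "inv s \<otimes> t \<in> E"
    using assms by (auto simp: l_coset_def subset_iff simp flip: m_assoc)
next
  assume "inv s \<otimes> t \<in> E"
  moreover have "t = s \<otimes> (inv s \<otimes> t)"
    using assms by (simp flip: m_assoc)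
  ultimately show "t \<in> s <# E" by (auto simp: l_coset_def)
qed

lemma inv_l_coset_mem_iff:
  assumes "s \<in> carrier G" "t \<in> carrier G" "E \<subseteq> carrier G"
  shows "t \<in> inv s <# E \<longleftrightarrow> s \<otimes> t \<in> E"
  using l_coset_mem_iff[of "inv s" t E] assms by simp

lemma l_coset_carrier: "s \<in> carrier G \<Longrightarrow> E \<subseteq> carrier G \<Longrightarrow> s <# E \<subseteq> carrier G"
  by (auto simp: l_coset_def)

lemma finite_l_coset: "finite E \<Longrightarrow> finite (s <# E)"
  by (auto simp: l_coset_def)

lemma l_coset_assoc:
  "r \<in> carrier G \<Longrightarrow> s \<in> carrier G \<Longrightarrow> E \<subseteq> carrier G \<Longrightarrow> r <# (s <# E) = (r \<otimes> s) <# E"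
  by (rule lcos_m_assoc)

text \<open>
  By invariance all points have the same measure, and a countable union of null points would make
  the whole group null.
\<close>
lemma haar_singleton_pos:
  assumes "x \<in> carrier G"
  shows "emeasure \<mu> {x} > 0"
proof (rule ccontr)
  assume "\<not> emeasure \<mu> {x} > 0"
  then have x: "emeasure \<mu> {x} = 0" by simp
  have null: "{y} \<in> null_sets \<mu>" if y: "y \<in> carrier G" for y
  proof -
    have "(y \<otimes> inv x) <# {x} = {y}"
      using assms y by (simp add: l_coset_def m_assoc)
    then have "emeasure \<mu> {y} = emeasure \<mu> {x}"
      using haar_invariant[of "y \<otimes> inv x" "{x}"] assms y by simp
    then show ?thesis using x y by (auto simp: null_sets_def sets_haar)
  qed
  have "(\<Union>y\<in>carrier G. {y}) \<in> null_sets \<mu>"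
    by (rule null_sets_UN'[OF countable_carrier]) (rule null)
  then show False using haar_nonzero by (simp add: null_sets_def)
qed

lemma mass_mono: "A \<subseteq> B \<Longrightarrow> mass A \<le> mass B"
  unfolding mass_def by (intro nn_integral_mono) (auto simp: indicator_def)

lemma mass_finite:
  assumes "finite E" "E \<subseteq> carrier G"
  shows "mass E < \<infinity>"
proof -
  define M where "M = (\<Sum>t\<in>E. \<omega> t powr p)"
  have "mass E \<le> (\<integral>\<^sup>+t. ennreal M * indicator E t \<partial>\<mu>)"
    unfolding mass_def
    by (intro nn_integral_mono)
       (auto simp: M_def indicator_def intro!: ennreal_leI member_le_sum assms)
  also have "\<dots> = ennreal M * emeasure \<mu> E"
    using assms by (intro nn_integral_cmult_indicator) (simp add: sets_haar)
  also have "\<dots> < \<infinity>"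
    using haar_finite[OF assms(2,1)] by (simp add: ennreal_mult_less_top)
  finally show ?thesis .
qed

lemma mass_singleton_pos:
  assumes "t \<in> carrier G"
  shows "mass {t} > 0"
proof -
  have "mass {t} = (\<integral>\<^sup>+x. ennreal (\<omega> t powr p) * indicator {t} x \<partial>\<mu>)"
    unfolding mass_def by (intro nn_integral_cong) (auto simp: indicator_def)
  also have "\<dots> = ennreal (\<omega> t powr p) * emeasure \<mu> {t}"
    using assms by (intro nn_integral_cmult_indicator) (simp add: sets_haar)
  finally show ?thesis
    using haar_singleton_pos[OF assms] weight_pos[OF assms]
    by (simp add: ennreal_zero_less_mult_iff)
qed

lemma norm_weight_powr:
  "t \<in> carrier G \<Longrightarrow>
    norm (z * of_real (\<omega> t) :: complex) powr p = norm z powr p * \<omega> t powr p"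
  using weight_pos[of t] by (simp add: norm_mult powr_mult)

lemma modular_cong:
  "(\<And>t. t \<in> carrier G \<Longrightarrow> f t = g t) \<Longrightarrow> modular f = modular g"
  unfolding modular_def by (intro nn_integral_cong) (auto simp: space_haar)

text \<open>
  Chebyshev's inequality for the weighted measure.
\<close>
lemma mass_le_modular:
  assumes "0 \<le> K" "\<And>x. x \<in> E \<Longrightarrow> K \<le> norm (h x)"
  shows "ennreal (K powr p) * mass E \<le> modular h"
proof -
  have "ennreal (K powr p) * mass E =
      (\<integral>\<^sup>+t. ennreal (K powr p) * (ennreal (\<omega> t powr p) * indicator E t) \<partial>\<mu>)"
    unfolding mass_def by (intro nn_integral_cmult[symmetric] haar_measurable)
  also have "\<dots> \<le> modular h"
    unfolding modular_def
  proof (intro nn_integral_mono)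
    fix t assume "t \<in> space \<mu>"
    then have t: "t \<in> carrier G" by (simp add: space_haar)
    have "K powr p * \<omega> t powr p \<le> norm (h t) powr p * \<omega> t powr p" if "t \<in> E"
      using assms that p_ge_1 by (intro mult_right_mono powr_mono2) auto
    then show "ennreal (K powr p) * (ennreal (\<omega> t powr p) * indicator E t)
        \<le> ennreal (norm (h t * of_real (\<omega> t)) powr p)"
      using norm_weight_powr[OF t] by (auto simp: indicator_def simp flip: ennreal_mult'')
  qed
  finally show ?thesis .
qed

text \<open>
  At each point of the support of \<open>h\<close> a single summand already dominates the integrand, so the
  sets may overlap.
\<close>
lemma modular_le_suminf_mass:
  assumes "\<And>t. t \<in> carrier G \<Longrightarrow> h t \<noteq> 0 \<Longrightarrow> \<exists>i. t \<in> E i \<and> norm (h t) \<le> M i"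
  shows "modular h \<le> (\<Sum>i::nat. ennreal (M i powr p) * mass (E i))"
proof -
  have "modular h \<le>
      (\<integral>\<^sup>+t. (\<Sum>i. ennreal (M i powr p) * (ennreal (\<omega> t powr p) * indicator (E i) t)) \<partial>\<mu>)"
    unfolding modular_def
  proof (intro nn_integral_mono)
    fix t assume "t \<in> space \<mu>"
    then have t: "t \<in> carrier G" by (simp add: space_haar)
    let ?u = "\<lambda>i. ennreal (M i powr p) * (ennreal (\<omega> t powr p) * indicator (E i) t)"
    show "ennreal (norm (h t * of_real (\<omega> t)) powr p) \<le> (\<Sum>i. ?u i)"
    proof (cases "h t = 0")
      case False
      then obtain i where i: "t \<in> E i" "norm (h t) \<le> M i" using assms t by blast
      have "norm (h t) powr p * \<omega> t powr p \<le> M i powr p * \<omega> t powr p"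
        using i p_ge_1 by (intro mult_right_mono powr_mono2) auto
      then have "ennreal (norm (h t * of_real (\<omega> t)) powr p) \<le> ?u i"
        using norm_weight_powr[OF t] i by (auto simp flip: ennreal_mult'')
      also have "\<dots> \<le> (\<Sum>i. ?u i)"
        using sum_le_suminf[of ?u "{i}"] by simp
      finally show ?thesis .
    qed simp
  qed
  also have "\<dots> = (\<Sum>i. ennreal (M i powr p) * mass (E i))"
    unfolding mass_def
    by (subst nn_integral_suminf) (auto intro!: haar_measurable simp: nn_integral_cmult haar_measurable)
  finally show ?thesis .
qed

text \<open>
  A substitute for Minkowski's inequality that holds also when an integral is infinite: it costs a
  factor, which a density argument absorbs into the choice of the errors.
\<close>
lemma modular_add_le:
  "modular (\<lambda>t. f t + g t) \<le> ennreal (2 powr p) * (modular f + modular g)"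
proof -
  have *: "(x + y) powr p \<le> 2 powr p * (x powr p + y powr p)" if "0 \<le> x" "0 \<le> y" for x y :: real
  proof -
    have "(x + y) powr p \<le> (2 * max x y) powr p"
      using that p_ge_1 by (intro powr_mono2) auto
    also have "\<dots> = 2 powr p * max x y powr p" using that by (simp add: powr_mult)
    also have "\<dots> \<le> 2 powr p * (x powr p + y powr p)"
      by (intro mult_left_mono) (auto simp: max_def)
    finally show ?thesis .
  qed
  have "modular (\<lambda>t. f t + g t) \<le>
     (\<integral>\<^sup>+t. ennreal (2 powr p) * (ennreal (norm (f t * of_real (\<omega> t)) powr p) +
        ennreal (norm (g t * of_real (\<omega> t)) powr p)) \<partial>\<mu>)"
    unfolding modular_def
  proof (intro nn_integral_mono)
    fix t
    let ?x = "norm (f t * of_real (\<omega> t))" and ?y = "norm (g t * of_real (\<omega> t))"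
    have "norm ((f t + g t) * of_real (\<omega> t)) powr p \<le> (?x + ?y) powr p"
      using p_ge_1 by (intro powr_mono2) (auto simp: distrib_right intro: norm_triangle_ineq)
    also have "\<dots> \<le> 2 powr p * (?x powr p + ?y powr p)" by (rule *) auto
    finally show "ennreal (norm ((f t + g t) * of_real (\<omega> t)) powr p) \<le>
        ennreal (2 powr p) * (ennreal (?x powr p) + ennreal (?y powr p))"
      by (simp add: ennreal_leI flip: ennreal_plus ennreal_mult)
  qed
  also have "\<dots> = ennreal (2 powr p) * (modular f + modular g)"
    unfolding modular_def
    by (simp add: nn_integral_cmult nn_integral_add haar_measurable)
  finally show ?thesis .
qed

lemma weighted_Lp_iff: "f \<in> weighted_Lp \<mu> p \<omega> \<longleftrightarrow> f \<in> extensional (carrier G) \<and> modular f < \<infinity>"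
  by (auto simp: weighted_Lp_def modular_def space_haar haar_measurable)

lemma weighted_Lp_norm_eq: "weighted_Lp_norm \<mu> p \<omega> f = enn2real (modular f) powr (1 / p)"
  by (simp add: weighted_Lp_norm_def modular_def)

lemma weighted_Lp_norm_lessI:
  assumes "0 < \<epsilon>" "modular h < ennreal (\<epsilon> powr p)"
  shows "weighted_Lp_norm \<mu> p \<omega> h < \<epsilon>"
proof -
  have "enn2real (modular h) < \<epsilon> powr p"
    using assms by (cases "modular h") (auto simp: ennreal_less_iff)
  then have "enn2real (modular h) powr (1 / p) < (\<epsilon> powr p) powr (1 / p)"
    using p_ge_1 by (intro powr_less_mono2) auto
  then show ?thesis using assms p_ge_1 by (simp add: weighted_Lp_norm_eq powr_powr)
qed

text \<open>
  The finiteness assumption excludes functions whose norm is \<open>0\<close> by the convention for infinite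
  integrals.
\<close>
lemma modular_less_of_norm_less:
  assumes "modular h < \<infinity>" "0 < \<delta>" "weighted_Lp_norm \<mu> p \<omega> h < \<delta> powr (1 / p)"
  shows "modular h < ennreal \<delta>"
proof -
  have "enn2real (modular h) < \<delta>"
  proof (rule ccontr)
    assume "\<not> enn2real (modular h) < \<delta>"
    then have "\<delta> powr (1 / p) \<le> enn2real (modular h) powr (1 / p)"
      using assms(2) p_ge_1 by (intro powr_mono2) auto
    then show False using assms(3) by (simp add: weighted_Lp_norm_eq)
  qed
  then show ?thesis using assms by (cases "modular h") (auto simp: ennreal_less_iff)
qed

section \<open>From a dense vector to summable packings\<close>


text \<open>
  Boundedness of \<open>T\<^sub>s\<close> tested on indicator functions, since \<open>T\<^sub>s\<close> maps the indicator of \<open>E\<close> to that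
  of \<open>sE\<close>.
\<close>
lemma mass_translate_bound:
  assumes adm: "admissible_weight G \<mu> p S \<omega>" and S: "S \<subseteq> carrier G" and s: "s \<in> S"
  obtains C where "0 \<le> C"
    "\<And>E. finite E \<Longrightarrow> E \<subseteq> carrier G \<Longrightarrow> mass (s <# E) \<le> ennreal C * mass E"
proof -
  from adm s obtain C where C: "\<And>f. f \<in> weighted_Lp \<mu> p \<omega> \<Longrightarrow>
        weighted_Lp_norm \<mu> p \<omega> (left_translation G s f) \<le> C * weighted_Lp_norm \<mu> p \<omega> f"
    unfolding admissible_weight_def by blast
  have sG: "s \<in> carrier G" using S s by auto
  show thesis
  proof (rule that)
    show "0 \<le> \<bar>C\<bar> powr p" by simp
    fix E assume E: "finite E" "E \<subseteq> carrier G"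
    define f :: "'a \<Rightarrow> complex" where "f = (\<lambda>t\<in>carrier G. of_bool (t \<in> E))"
    have indicator_modular: "modular (\<lambda>t. of_bool (t \<in> A)) = mass A" for A
      unfolding modular_def mass_def
      by (intro nn_integral_cong) (auto simp: indicator_def norm_mult weight_pos less_imp_le space_haar)
    have f: "modular f = mass E"
      by (subst indicator_modular[symmetric], rule modular_cong) (simp add: f_def)
    have Tf: "modular (left_translation G s f) = mass (s <# E)"
      by (subst indicator_modular[symmetric], rule modular_cong)
         (use sG E in \<open>simp add: f_def left_translation_def l_coset_mem_iff\<close>)
    define a where "a = enn2real (mass E)"
    define b where "b = enn2real (mass (s <# E))"
    have fin: "mass E < \<infinity>" "mass (s <# E) < \<infinity>"
      using mass_finite[OF E] mass_finite[OF finite_l_coset[OF E(1)] l_coset_carrier[OF sG E(2)]]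
      by auto
    have "f \<in> weighted_Lp \<mu> p \<omega>"
      using fin f by (simp add: weighted_Lp_iff f_def)
    from C[OF this] have "b powr (1 / p) \<le> C * a powr (1 / p)"
      by (simp add: weighted_Lp_norm_eq f Tf a_def b_def)
    also have "\<dots> \<le> \<bar>C\<bar> * a powr (1 / p)" by (intro mult_right_mono) auto
    finally have "(b powr (1 / p)) powr p \<le> (\<bar>C\<bar> * a powr (1 / p)) powr p"
      using p_ge_1 by (intro powr_mono2) auto
    then have "b \<le> \<bar>C\<bar> powr p * a"
      using p_ge_1 by (simp add: powr_powr powr_mult a_def b_def)
    then have "ennreal b \<le> ennreal (\<bar>C\<bar> powr p) * ennreal a"
      by (simp add: ennreal_leI flip: ennreal_mult')
    then show "mass (s <# E) \<le> ennreal (\<bar>C\<bar> powr p) * mass E"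
      using fin by (simp add: a_def b_def)
  qed
qed

lemma finite_mass_translate_bound:
  assumes adm: "admissible_weight G \<mu> p S \<omega>" and S: "S \<subseteq> carrier G"
    and R: "finite R" "R \<subseteq> insert \<one> S"
  obtains C where "0 \<le> C"
    "\<And>r E. r \<in> R \<Longrightarrow> finite E \<Longrightarrow> E \<subseteq> carrier G \<Longrightarrow> mass (r <# E) \<le> ennreal C * mass E"
proof -
  have "\<exists>C\<ge>0. \<forall>E. finite E \<longrightarrow> E \<subseteq> carrier G \<longrightarrow> mass (r <# E) \<le> ennreal C * mass E"
    if "r \<in> R" for r
  proof (cases "r = \<one>")
    case True
    then show ?thesis by (intro exI[of _ 1]) (auto simp: lcos_mult_one)
  next
    case False
    then have "r \<in> S" using that R by auto
    then show ?thesis by (rule mass_translate_bound[OF adm S]) blast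
  qed
  then obtain C where C: "\<And>r. r \<in> R \<Longrightarrow> 0 \<le> C r"
    "\<And>r E. r \<in> R \<Longrightarrow> finite E \<Longrightarrow> E \<subseteq> carrier G \<Longrightarrow> mass (r <# E) \<le> ennreal (C r) * mass E"
    by metis
  show thesis
  proof (rule that)
    show "0 \<le> (\<Sum>r\<in>R. C r)" using C by (auto intro: sum_nonneg)
    fix r E assume r: "r \<in> R" and E: "finite E" "E \<subseteq> carrier G"
    have "ennreal (C r) \<le> ennreal (\<Sum>r\<in>R. C r)"
      using R r C by (intro ennreal_leI member_le_sum) auto
    then show "mass (r <# E) \<le> ennreal (\<Sum>r\<in>R. C r) * mass E"
      using C(2)[OF r E] by (meson mult_right_mono order_trans zero_le)
  qed
qed

text \<open>
  One step of the recursive choice. In the intended use \<open>B\<close> is the union of the sets placed so far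
  and \<open>R\<close> consists of the group elements chosen so far. The bound \<open>1 \<le> norm (f x)\<close> on the new set is
  what allows it to be included in \<open>B\<close> later.
\<close>
lemma dense_vector_step:
  assumes adm: "admissible_weight G \<mu> p S \<omega>" and S: "S \<subseteq> carrier G"
    and f: "dense_vector G \<mu> p S \<omega> f"
    and F: "finite F" "F \<subseteq> carrier G"
    and B: "finite B" "B \<subseteq> carrier G" "\<And>x. x \<in> B \<Longrightarrow> 1 \<le> norm (f x)"
    and R: "finite R" "R \<subseteq> insert \<one> S"
    and eta: "0 < \<eta>"
  obtains s where "s \<in> S" "\<And>x. x \<in> inv s <# F \<Longrightarrow> 1 \<le> norm (f x)"
    "(inv s <# F) \<inter> B = {}"
    "\<And>r. r \<in> R \<Longrightarrow> mass ((r \<otimes> inv s) <# F) \<le> ennreal \<eta>"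
    "mass (s <# B) \<le> ennreal \<eta>"
proof -
  have RG: "R \<subseteq> carrier G" using R S by auto
  obtain C where C: "0 \<le> C"
    "\<And>r E. r \<in> R \<Longrightarrow> finite E \<Longrightarrow> E \<subseteq> carrier G \<Longrightarrow> mass (r <# E) \<le> ennreal C * mass E"
    using finite_mass_translate_bound[OF adm S R] by blast
  have f_Lp: "f \<in> weighted_Lp \<mu> p \<omega>" using f by (simp add: dense_vector_def)
  define a where "a = enn2real (modular f)"
  have a: "0 \<le> a" "modular f = ennreal a"
    using f_Lp by (auto simp: weighted_Lp_iff a_def)
  (* K exceeds 1, for the lower bound on f; it exceeds |f| on B, for disjointness from B; and
     K^p >= K >= C a / \<eta>, so that C times the mass of the new set is at most \<eta>. *)
  define K where "K = 1 + (\<Sum>x\<in>B. norm (f x)) + C * a / \<eta>"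
  have sumB: "0 \<le> (\<Sum>x\<in>B. norm (f x))" by (simp add: sum_nonneg)
  have K1: "1 \<le> K" using C a eta sumB by (simp add: K_def)
  have KB: "norm (f x) < K" if "x \<in> B" for x
  proof -
    have "norm (f x) \<le> (\<Sum>x\<in>B. norm (f x))" using that B by (intro member_le_sum) auto
    moreover have "0 \<le> C * a / \<eta>" using C a eta by simp
    ultimately show ?thesis by (simp add: K_def)
  qed
  have Kp: "K \<le> K powr p" using powr_mono[of 1 p K] K1 p_ge_1 by simp
  have KC: "C * a \<le> \<eta> * K powr p"
  proof -
    have "C * a / \<eta> \<le> K" using sumB by (simp add: K_def)
    also note Kp
    finally show ?thesis using eta by (simp add: field_simps)
  qed
  have "\<exists>w>0. \<forall>t\<in>F. ennreal w \<le> mass {t}"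
  proof (intro exI conjI ballI)
    let ?w = "Min (insert 1 ((\<lambda>t. enn2real (mass {t})) ` F))"
    have fin: "mass {t} < \<infinity>" if "t \<in> F" for t
      using that F by (intro mass_finite) auto
    have "0 < enn2real (mass {t})" if "t \<in> F" for t
      using that F fin[OF that] mass_singleton_pos[of t] by (auto simp: enn2real_positive_iff)
    then show "0 < ?w" using F by simp
    fix t assume t: "t \<in> F"
    then have "?w \<le> enn2real (mass {t})" using F by (intro Min_le) auto
    then have "ennreal ?w \<le> ennreal (enn2real (mass {t}))" by (rule ennreal_leI)
    also have "\<dots> = mass {t}" using fin[OF t] by (intro ennreal_enn2real) simp
    finally show "ennreal ?w \<le> mass {t}" .
  qed
  then obtain w where w: "0 < w" "\<And>t. t \<in> F \<Longrightarrow> ennreal w \<le> mass {t}" by blast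
  (* An error of modulus at least K at a single point of F already costs K^p w, so a total error
     below \<delta> forces |f| >= K on the translated set. *)
  define \<delta> where "\<delta> = min \<eta> (K powr p * w)"
  have d: "0 < \<delta>" using eta K1 w by (simp add: \<delta>_def)
  define g :: "'a \<Rightarrow> complex" where "g = (\<lambda>t\<in>carrier G. if t \<in> F then of_real (2 * K) else 0)"
  have "modular g \<le> (\<Sum>i. ennreal ((if i = 0 then 2 * K else 0) powr p) * mass F)"
    using K1 by (intro modular_le_suminf_mass) (auto simp: g_def norm_mult split: if_splits)
  also have "\<dots> = (\<Sum>i\<in>{0::nat}. ennreal ((if i = 0 then 2 * K else 0) powr p) * mass F)"
    by (intro suminf_finite) auto
  also have "\<dots> < \<infinity>"
    using mass_finite[OF F] by (simp add: ennreal_mult_less_top)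
  finally have g_Lp: "g \<in> weighted_Lp \<mu> p \<omega>" by (simp add: weighted_Lp_iff g_def)
  obtain s where s: "s \<in> S"
    "weighted_Lp_norm \<mu> p \<omega> (\<lambda>t. left_translation G s f t - g t) < \<delta> powr (1 / p)"
    using f g_Lp d unfolding dense_vector_def by (metis powr_gt_zero less_imp_neq)
  have sG: "s \<in> carrier G" using s S by auto
  let ?h = "\<lambda>t. left_translation G s f t - g t"
  have "left_translation G s f \<in> weighted_Lp \<mu> p \<omega>"
    using adm s f_Lp unfolding admissible_weight_def by blast
  then have "modular (left_translation G s f) < \<infinity>" "modular (\<lambda>t. - g t) < \<infinity>"
    using g_Lp by (auto simp: weighted_Lp_iff modular_def norm_mult)
  then have "modular ?h < \<infinity>"
    using modular_add_le[of "left_translation G s f" "\<lambda>t. - g t"]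
    by (auto simp: ennreal_mult_less_top intro: le_less_trans)
  then have h: "modular ?h < ennreal \<delta>"
    using s d by (intro modular_less_of_norm_less)
  have large: "K \<le> norm (f x)" if "x \<in> inv s <# F" for x
  proof (rule ccontr)
    assume small: "\<not> K \<le> norm (f x)"
    have xG: "x \<in> carrier G" using that l_coset_carrier[of "inv s" F] sG F by auto
    define t where "t = s \<otimes> x"
    have t: "t \<in> F" "t \<in> carrier G" "inv s \<otimes> t = x"
      using that inv_l_coset_mem_iff[OF sG xG F(2)] xG sG by (auto simp: t_def simp flip: m_assoc)
    (* |f x| < K at distance at least K from the target value 2K. *)
    have "norm (of_real (2 * K) :: complex) - norm (f x) \<le> norm (?h t)"
      using t norm_triangle_ineq2[of "of_real (2 * K) :: complex" "f x"]
      by (simp add: g_def left_translation_def norm_minus_commute)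
    then have "K \<le> norm (?h t)" using small K1 by (simp add: norm_mult)
    then have "ennreal (K powr p) * mass {t} \<le> modular ?h"
      using K1 by (intro mass_le_modular) auto
    then have "ennreal (K powr p) * mass {t} < ennreal \<delta>" using h by simp
    also have "\<dots> \<le> ennreal (K powr p * w)" by (intro ennreal_leI) (simp add: \<delta>_def)
    also have "\<dots> = ennreal (K powr p) * ennreal w" using w by (simp add: ennreal_mult)
    also have "\<dots> \<le> ennreal (K powr p) * mass {t}"
      using w(2)[OF t(1)] by (intro mult_left_mono) auto
    finally show False by simp
  qed
  have disj: "(inv s <# F) \<inter> B = {}" using large KB by force
  have sF: "finite (inv s <# F)" "inv s <# F \<subseteq> carrier G"
    using finite_l_coset[OF F(1)] l_coset_carrier[OF inv_closed[OF sG] F(2)] by auto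
  show thesis
  proof (rule that[OF s(1) _ disj])
    show "1 \<le> norm (f x)" if "x \<in> inv s <# F" for x using large[OF that] K1 by simp
    show "mass ((r \<otimes> inv s) <# F) \<le> ennreal \<eta>" if r: "r \<in> R" for r
    proof -
      have "ennreal (K powr p) * mass (inv s <# F) \<le> ennreal a"
        using mass_le_modular[of K "inv s <# F" f] large K1 a by simp
      then have "ennreal C * (ennreal (K powr p) * mass (inv s <# F)) \<le> ennreal C * ennreal a"
        by (intro mult_left_mono) auto
      also have "\<dots> \<le> ennreal (K powr p) * ennreal \<eta>"
        using KC C a eta by (simp add: mult.commute ennreal_leI flip: ennreal_mult)
      finally have "ennreal (K powr p) * (ennreal C * mass (inv s <# F))
          \<le> ennreal (K powr p) * ennreal \<eta>" by (simp add: ac_simps)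
      then have "ennreal C * mass (inv s <# F) \<le> ennreal \<eta>"
        using K1 by (subst (asm) ennreal_mult_le_mult_iff) auto
      moreover have "mass (r <# (inv s <# F)) \<le> ennreal C * mass (inv s <# F)"
        using C(2)[OF r sF] .
      moreover have "r <# (inv s <# F) = (r \<otimes> inv s) <# F"
        using r RG sG F by (intro l_coset_assoc) auto
      ultimately show ?thesis by simp
    qed
    (* The target function vanishes on sB because the new set and B are disjoint, whereas the
       translate of f has modulus at least 1 there. *)
    have "1 \<le> norm (?h t)" if "t \<in> s <# B" for t
    proof -
      have t: "t \<in> carrier G" using that l_coset_carrier[of s B] sG B by auto
      then have x: "inv s \<otimes> t \<in> B" using that l_coset_mem_iff[OF sG t B(2)] by simp
      then have "inv s \<otimes> t \<notin> inv s <# F" using disj by auto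
      then have "t \<notin> F" by (auto simp: l_coset_def)
      then show ?thesis using t B(3)[OF x] by (simp add: g_def left_translation_def)
    qed
    then have "ennreal (1 powr p) * mass (s <# B) \<le> modular ?h"
      by (intro mass_le_modular) auto
    then have "mass (s <# B) \<le> modular ?h" by simp
    also have "\<dots> \<le> ennreal \<delta>" using h by simp
    also have "\<dots> \<le> ennreal \<eta>" by (intro ennreal_leI) (simp add: \<delta>_def)
    finally show "mass (s <# B) \<le> ennreal \<eta>" .
  qed
qed

definition summable_packing :: "(nat \<Rightarrow> 'a set) \<Rightarrow> (nat \<Rightarrow> 'a) \<Rightarrow> bool" where
  "summable_packing F s \<longleftrightarrow> disjoint_family_on (\<lambda>n. inv (s n) <# F n) {1..} \<and>
     (\<Sum>\<^sub>\<infinity>(n, k)\<in>{(n, k). n \<noteq> k}. mass ((s n \<otimes> inv (s k)) <# F k)) < \<infinity>"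

definition admits_summable_packings :: "'a set \<Rightarrow> bool" where
  "admits_summable_packings S \<longleftrightarrow> (\<forall>F.
     F 0 = {} \<and> (\<forall>n\<ge>1. finite (F n) \<and> F n \<subseteq> carrier G \<and> F n \<subseteq> F (Suc n)) \<longrightarrow>
     (\<exists>s. s 0 = \<one> \<and> (\<forall>n\<ge>1. s n \<in> S) \<and> summable_packing F s))"

text \<open>
  The recursion bounds each entry of the double series by the power of \<open>1/4\<close> whose exponent is the
  larger of the two indices. Such a power is at most \<open>(1/2)\<close> to the sum of the indices, a product that is
  summable over all pairs.
\<close>
lemma dense_vector_imp_summable_packing:
  assumes adm: "admissible_weight G \<mu> p S \<omega>" and S: "S \<subseteq> carrier G"
    and f: "dense_vector G \<mu> p S \<omega> f"
    and F0: "F 0 = {}" and F: "\<And>n. finite (F n)" "\<And>n. F n \<subseteq> carrier G"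
  obtains s where "s 0 = \<one>" "\<And>n. n \<ge> 1 \<Longrightarrow> s n \<in> S" "summable_packing F s"
proof -
  define P where "P s n r \<longleftrightarrow> (if n = 0 then r = \<one> else
      r \<in> S \<and> (\<forall>x\<in>inv r <# F n. 1 \<le> norm (f x)) \<and>
      (\<forall>k<n. (inv r <# F n) \<inter> (inv (s k) <# F k) = {} \<and>
        mass ((r \<otimes> inv (s k)) <# F k) \<le> ennreal ((1/4) ^ n) \<and>
        mass ((s k \<otimes> inv r) <# F n) \<le> ennreal ((1/4) ^ n)))"
    for s :: "nat \<Rightarrow> 'a" and n r
  have "\<exists>s. \<forall>n. P s n (s n)"
  proof (rule dependent_wellorder_choice)
    show "P s n r = P s' n r" if "\<And>k. k < n \<Longrightarrow> s k = s' k" for r s s' n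
      using that by (simp add: P_def)
    fix n :: nat and s assume IH: "\<And>k. k < n \<Longrightarrow> P s k (s k)"
    show "\<exists>r. P s n r"
    proof (cases "n = 0")
      case False
      (* F 0 is empty, so the index 0 does not violate the lower bound on f. *)
      define B where "B = (\<Union>k<n. inv (s k) <# F k)"
      have sS: "s k \<in> insert \<one> S" if "k < n" for k
        using IH[OF that] by (auto simp: P_def split: if_splits)
      then have sG: "s k \<in> carrier G" if "k < n" for k using S sS[OF that] by auto
      have B: "finite B" "B \<subseteq> carrier G"
        using finite_l_coset[OF F(1)] l_coset_carrier[OF inv_closed[OF sG] F(2)]
        unfolding B_def by blast+
      have Bf: "1 \<le> norm (f x)" if "x \<in> B" for x
      proof -
        obtain k where k: "k < n" "x \<in> inv (s k) <# F k" using \<open>x \<in> B\<close> by (auto simp: B_def)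
        then have "k \<noteq> 0" using F0 by (cases "k = 0") (auto simp: l_coset_def)
        then show ?thesis using IH[OF k(1)] k(2) by (simp add: P_def)
      qed
      obtain r where r: "r \<in> S" "\<And>x. x \<in> inv r <# F n \<Longrightarrow> 1 \<le> norm (f x)"
        "(inv r <# F n) \<inter> B = {}"
        "\<And>q. q \<in> s ` {..<n} \<Longrightarrow> mass ((q \<otimes> inv r) <# F n) \<le> ennreal ((1/4) ^ n)"
        "mass (r <# B) \<le> ennreal ((1/4) ^ n)"
        using sS by (elim dense_vector_step[OF adm S f F(1)[of n] F(2)[of n] B Bf,
              where R = "s ` {..<n}" and \<eta> = "(1/4) ^ n", rotated 4]) auto
      have "mass ((r \<otimes> inv (s k)) <# F k) \<le> ennreal ((1/4) ^ n)" if "k < n" for k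
      proof -
        have "(r \<otimes> inv (s k)) <# F k = r <# (inv (s k) <# F k)"
          using r S sG[OF that] F by (intro l_coset_assoc[symmetric]) auto
        also have "\<dots> \<subseteq> r <# B" using that by (auto simp: B_def l_coset_def)
        finally show ?thesis using mass_mono r(5) order_trans by blast
      qed
      then have "P s n r" using r False by (auto simp: P_def B_def)
      then show ?thesis ..
    qed (simp add: P_def)
  qed
  then obtain s where s: "\<And>n. P s n (s n)" by blast
  have s0: "s 0 = \<one>" using s[of 0] by (simp add: P_def)
  have sn: "s n \<in> S" "\<And>k. k < n \<Longrightarrow> (inv (s n) <# F n) \<inter> (inv (s k) <# F k) = {}"
    "\<And>k. k < n \<Longrightarrow> mass ((s n \<otimes> inv (s k)) <# F k) \<le> ennreal ((1/4) ^ n)"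
    "\<And>k. k < n \<Longrightarrow> mass ((s k \<otimes> inv (s n)) <# F n) \<le> ennreal ((1/4) ^ n)" if "n \<ge> 1" for n
    using s[of n] that by (auto simp: P_def)
  have disj: "disjoint_family_on (\<lambda>n. inv (s n) <# F n) {1..}"
    unfolding disjoint_family_on_def
  proof (intro ballI impI)
    fix m n :: nat assume "m \<in> {1..}" "n \<in> {1..}" "m \<noteq> n"
    then show "(inv (s m) <# F m) \<inter> (inv (s n) <# F n) = {}"
      using sn(2)[of m n] sn(2)[of n m] by (cases "m < n") auto
  qed
  have entry: "mass ((s n \<otimes> inv (s k)) <# F k) \<le> ennreal ((1/2) ^ n) * ennreal ((1/2) ^ k)"
    if "n \<noteq> k" for n k
  proof -
    have *: "mass ((s n \<otimes> inv (s k)) <# F k) \<le> ennreal ((1/4) ^ max n k)"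
      using that sn(3)[of n k] sn(4)[of k n] by (cases "k < n") (auto simp: max_def)
    have "(1/4 :: real) ^ max n k = (1/2) ^ (2 * max n k)"
      by (simp add: power_mult power2_eq_square)
    also have "\<dots> \<le> (1/2) ^ (n + k)" by (intro power_decreasing) auto
    finally have "ennreal ((1/4) ^ max n k) \<le> ennreal ((1/2) ^ n * (1/2) ^ k)"
      by (intro ennreal_leI) (simp add: power_add)
    with * show ?thesis by (simp add: ennreal_mult)
  qed
  have "(\<Sum>n. \<Sum>k. if n = k then 0 else mass ((s n \<otimes> inv (s k)) <# F k))
      \<le> (\<Sum>n. \<Sum>k. ennreal ((1/2) ^ n) * ennreal ((1/2) ^ k))"
    by (intro suminf_le summableI) (split if_split, intro conjI impI zero_le entry)
  also have "\<dots> = 2 * 2" by (simp only: ennreal_suminf_cmult ennreal_suminf_multc suminf_ennreal_half_power)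
  also have "\<dots> < \<infinity>" by (simp add: ennreal_mult_less_top)
  finally have "summable_packing F s"
    using disj by (simp add: summable_packing_def infsum_off_diagonal)
  then show thesis using that s0 sn(1) by blast
qed

lemma dense_vector_imp_admits_summable_packings:
  assumes "admissible_weight G \<mu> p S \<omega>" "S \<subseteq> carrier G" "dense_vector G \<mu> p S \<omega> f"
  shows "admits_summable_packings S"
  unfolding admits_summable_packings_def
proof (intro allI impI)
  fix F assume F: "F 0 = {} \<and> (\<forall>n\<ge>1. finite (F n) \<and> F n \<subseteq> carrier G \<and> F n \<subseteq> F (Suc n))"
  have "finite (F n)" "F n \<subseteq> carrier G" for n using F by (cases n; simp)+
  with F obtain s where "s 0 = \<one>" "\<And>n. n \<ge> 1 \<Longrightarrow> s n \<in> S" "summable_packing F s"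
    using dense_vector_imp_summable_packing[OF assms, of F] by blast
  then show "\<exists>s. s 0 = \<one> \<and> (\<forall>n\<ge>1. s n \<in> S) \<and> summable_packing F s" by blast
qed

section \<open>From summable packings to a dense vector\<close>

text \<open>
  Elements vanish outside the group instead of being undefined there, so that finite support makes
  sense; the modular depends only on values in the group.
\<close>
definition finsupp_funs :: "complex set \<Rightarrow> ('a \<Rightarrow> complex) set" where
  "finsupp_funs Q = {d. finite {t. d t \<noteq> 0} \<and> {t. d t \<noteq> 0} \<subseteq> carrier G \<and> (\<forall>t. d t \<in> insert 0 Q)}"

lemma countable_finsupp_funs:
  assumes "countable Q"
  shows "countable (finsupp_funs Q)"
proof (rule countable_image_inj_on)
  let ?graph = "\<lambda>d. (\<lambda>t. (t, d t)) ` {t. d t \<noteq> 0}"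
  have "?graph ` finsupp_funs Q \<subseteq> {A. A \<subseteq> carrier G \<times> Q \<and> finite A}"
    by (auto simp: finsupp_funs_def)
  moreover have "countable {A. A \<subseteq> carrier G \<times> Q \<and> finite A}"
    using countable_Collect_finite_subset[of "carrier G \<times> Q"] countable_carrier assms
    by (simp add: conj_commute)
  ultimately show "countable (?graph ` finsupp_funs Q)" by (rule countable_subset)
  show "inj_on ?graph (finsupp_funs Q)"
  proof (rule inj_onI, rule ext)
    fix d d' :: "'a \<Rightarrow> complex" and t
    assume eq: "?graph d = ?graph d'"
    then have *: "(t, c) \<in> ?graph d \<longleftrightarrow> (t, c) \<in> ?graph d'" for c by simp
    show "d t = d' t"
      using *[of "d t"] *[of "d' t"] by (cases "d t = 0"; cases "d' t = 0") auto
  qed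
qed

text \<open>
  The approximants are chosen pointwise with error at most \<open>|g| / (n + 1)\<close> on the \<open>n\<close>-th finite set
  of an exhaustion of the group and are \<open>0\<close> outside of it. The relative error makes the difference
  dominated by \<open>g\<close> everywhere, so that dominated convergence applies.
\<close>
lemma finsupp_approx:
  assumes Q: "\<And>X. open X \<Longrightarrow> X \<noteq> {} \<Longrightarrow> \<exists>q\<in>Q. q \<in> X"
    and g: "modular g < \<infinity>" and "0 < \<eta>"
  obtains d where "d \<in> finsupp_funs Q" "modular (\<lambda>t. g t - d t) < \<eta>"
proof -
  have "\<exists>q\<in>insert 0 Q. norm (z - q) \<le> norm z / real (Suc n)" for z :: complex and n
  proof (cases "z = 0")
    case False
    then have "0 < norm z / real (Suc n)" by (intro divide_pos_pos) auto
    then have "ball z (norm z / real (Suc n)) \<noteq> {}" by (simp only: ball_eq_empty not_le)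
    then obtain q where "q \<in> Q" "q \<in> ball z (norm z / real (Suc n))"
      using Q[OF open_ball] by blast
    then show ?thesis by (intro bexI[of _ q]) (auto simp: dist_norm intro: less_imp_le)
  qed simp
  then obtain q where q: "\<And>z n. q z n \<in> insert 0 Q"
    "\<And>z n. norm (z - q z n) \<le> norm z / real (Suc n)" by metis
  define A where "A n = from_nat_into (carrier G) ` {..n}" for n :: nat
  have ne: "carrier G \<noteq> {}" using one_closed by blast
  have A: "finite (A n)" "A n \<subseteq> carrier G" for n
    using from_nat_into[OF ne] by (auto simp: A_def)
  define d where "d n t = (if t \<in> A n then q (g t) n else 0)" for n t
  have q0: "q 0 n = 0" for n using q(2)[of 0 n] by simp
  have d_fin: "d n \<in> finsupp_funs Q" for n
  proof -
    have "{t. d n t \<noteq> 0} \<subseteq> A n" by (auto simp: d_def)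
    moreover have "\<forall>t. d n t \<in> insert 0 Q" using q(1) by (auto simp: d_def)
    ultimately show ?thesis
      using A finite_subset unfolding finsupp_funs_def by blast
  qed
  have le: "norm (g t - d n t) \<le> norm (g t)" for n t
  proof -
    have "norm (g t) / real (Suc n) \<le> norm (g t)" by (simp add: field_simps)
    then show ?thesis using q(2)[of "g t" n] by (auto simp: d_def)
  qed
  have "(\<lambda>n. modular (\<lambda>t. g t - d n t)) \<longlonglongrightarrow> (\<integral>\<^sup>+t. 0 \<partial>\<mu>)"
    unfolding modular_def
  proof (rule nn_integral_dominated_convergence)
    show "(\<integral>\<^sup>+t. ennreal (norm (g t * of_real (\<omega> t)) powr p) \<partial>\<mu>) < \<infinity>"
      using g by (simp add: modular_def)
    show "AE t in \<mu>. ennreal (norm ((g t - d n t) * of_real (\<omega> t)) powr p)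
        \<le> ennreal (norm (g t * of_real (\<omega> t)) powr p)" for n
      using le p_ge_1
      by (intro AE_I2 ennreal_leI powr_mono2) (auto simp: norm_mult intro: mult_right_mono)
    show "AE t in \<mu>. (\<lambda>n. ennreal (norm ((g t - d n t) * of_real (\<omega> t)) powr p)) \<longlonglongrightarrow> 0"
    proof (rule AE_I2)
      fix t assume "t \<in> space \<mu>"
      then have t: "t \<in> carrier G" by (simp add: space_haar)
      then obtain N where N: "from_nat_into (carrier G) N = t"
        using from_nat_into_surj[OF countable_carrier] by blast
      have "(\<lambda>n. norm (g t) / real (Suc n)) \<longlonglongrightarrow> 0"
        using LIMSEQ_Suc[OF lim_const_over_n[of "norm (g t)"]] by simp
      then have "(\<lambda>n. g t - d n t) \<longlonglongrightarrow> 0"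
      proof (rule Lim_null_comparison[rotated])
        show "\<forall>\<^sub>F n in sequentially. norm (g t - d n t) \<le> norm (g t) / real (Suc n)"
          using eventually_ge_at_top[of N]
        proof eventually_elim
          case (elim n)
          then have "t \<in> A n" using N by (auto simp: A_def)
          then show ?case using q(2) by (simp add: d_def)
        qed
      qed
      then have "(\<lambda>n. norm ((g t - d n t) * of_real (\<omega> t))) \<longlonglongrightarrow> 0"
        by (intro tendsto_norm_zero tendsto_mult_left_zero)
      then have "(\<lambda>n. norm ((g t - d n t) * of_real (\<omega> t)) powr p) \<longlonglongrightarrow> 0 powr p"
        using p_ge_1 by (intro tendsto_powr2 tendsto_const) auto
      then have "(\<lambda>n. ennreal (norm ((g t - d n t) * of_real (\<omega> t)) powr p))
          \<longlonglongrightarrow> ennreal (0 powr p)"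
        by (rule tendsto_ennrealI)
      then show "(\<lambda>n. ennreal (norm ((g t - d n t) * of_real (\<omega> t)) powr p)) \<longlonglongrightarrow> 0"
        by simp
    qed
  qed (rule haar_measurable)+
  then have "(\<lambda>n. modular (\<lambda>t. g t - d n t)) \<longlonglongrightarrow> 0" by simp
  from order_tendstoD(2)[OF this \<open>0 < \<eta>\<close>] obtain n where "modular (\<lambda>t. g t - d n t) < \<eta>"
    using eventually_sequentially by auto
  then show thesis using that d_fin by blast
qed

text \<open>
  The vector \<open>f\<close> is a superposition of copies of all \<open>g i\<close> on pairwise disjoint sets. Translating the
  \<open>j\<close>-th copy back to its original position leaves an error that consists of the displaced other copies,
  and the summability of the packing controls exactly these.
\<close>
lemma summable_packings_imp_approximating_orbit:
  assumes S: "S \<subseteq> carrier G"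
    and packing: "admits_summable_packings S"
    and g: "\<And>i. finite {t. g i t \<noteq> 0}" "\<And>i. {t. g i t \<noteq> 0} \<subseteq> carrier G"
  shows "\<exists>f\<in>weighted_Lp \<mu> p \<omega>. \<exists>r. (\<forall>j. r j \<in> S) \<and>
    (\<lambda>j. modular (\<lambda>t. left_translation G (r j) f t - g j t)) \<longlonglongrightarrow> 0"
proof -
  define F where "F n = (\<Union>i<n. {t. g i t \<noteq> 0})" for n :: nat
  have F: "finite (F n)" "F n \<subseteq> carrier G" for n using g by (auto simp: F_def)
  have F_mono: "F n \<subseteq> F (Suc n)" for n unfolding F_def by (intro UN_mono) auto
  obtain s where s0: "s 0 = \<one>" and sS: "\<And>n. n \<ge> 1 \<Longrightarrow> s n \<in> S" and sp: "summable_packing F s"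
  proof -
    have "F 0 = {} \<and> (\<forall>n\<ge>1. finite (F n) \<and> F n \<subseteq> carrier G \<and> F n \<subseteq> F (Suc n))"
      using F F_mono by (simp add: F_def)
    then show thesis using packing that unfolding admits_summable_packings_def by blast
  qed
  have sG: "s n \<in> carrier G" for n using s0 sS[of n] S by (cases n) auto
  define E where "E n = inv (s n) <# F n" for n
  have E_iff: "t \<in> E n \<longleftrightarrow> s n \<otimes> t \<in> F n" if "t \<in> carrier G" for n t
    unfolding E_def by (rule inv_l_coset_mem_iff[OF sG that F(2)])
  have E_unique: "m = n" if "t \<in> E m" "t \<in> E n" for t m n
  proof -
    have "F 0 = {}" by (simp add: F_def)
    then have "m \<ge> 1" "n \<ge> 1" using that by (auto simp: E_def l_coset_def Suc_le_eq intro!: gr0I)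
    then show ?thesis
      using sp that unfolding summable_packing_def disjoint_family_on_def E_def by blast
  qed
  define u where "u n k = (if n = k then 0 else mass ((s n \<otimes> inv (s k)) <# F k))" for n k
  have "(\<Sum>k. \<Sum>n. u n k) = (\<Sum>n. \<Sum>k. u n k)" by (rule double_suminf_ennreal_swap)
  also have "\<dots> < \<infinity>"
    using sp by (simp add: summable_packing_def infsum_off_diagonal u_def)
  finally have u_fin: "(\<Sum>k. \<Sum>n. u n k) < \<infinity>" .
  define M where "M i = (\<Sum>t\<in>{t. g i t \<noteq> 0}. norm (g i t))" for i
  have M: "norm (g i t) \<le> M i" for i t
    using g(1)[of i] by (cases "g i t = 0") (auto simp: M_def intro!: sum_nonneg member_le_sum)
  (* The packing was chosen from the supports of the g i alone; passing to a sparse set of columns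
     absorbs their bounds M i. *)
  obtain k where k: "strict_mono k" "\<And>i. i < k i"
    "\<And>i. ennreal (M i powr p) * (\<Sum>n. u n (k i)) \<le> ennreal ((1/2) ^ i)"
    using sparse_subsequence[OF suminf_ennreal_finite_imp_LIMSEQ_zero[OF u_fin],
        of "\<lambda>i. M i powr p"] by blast
  have k_inj: "inj k" using k(1) by (rule strict_mono_imp_inj_on)
  have g_supp: "t \<in> F (k i)" if "g i t \<noteq> 0" for i t using that k(2)[of i] by (auto simp: F_def)
  have geo: "(\<Sum>i. ennreal ((1/2) ^ i)) < \<infinity>"
    unfolding suminf_ennreal_half_power by simp
  (* By disjointness the index selected below is the only one. *)
  define f where "f = (\<lambda>t\<in>carrier G. if \<exists>i. t \<in> E (k i)
      then let i = (SOME i. t \<in> E (k i)) in g i (s (k i) \<otimes> t) else 0)"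
  have f_on: "f t = g i (s (k i) \<otimes> t)" if "t \<in> carrier G" "t \<in> E (k i)" for i t
  proof -
    have "t \<in> E (k (SOME i. t \<in> E (k i)))" by (rule someI) (rule that(2))
    then have "k (SOME i. t \<in> E (k i)) = k i" using E_unique that(2) by blast
    then have "(SOME i. t \<in> E (k i)) = i" using k_inj by (simp add: inj_eq)
    then show ?thesis using that by (auto simp: f_def Let_def)
  qed
  have f_off: "\<exists>i. t \<in> E (k i) \<and> norm (f t) \<le> M i" if "t \<in> carrier G" "f t \<noteq> 0" for t
  proof -
    have "\<exists>i. t \<in> E (k i)" by (rule ccontr) (use that in \<open>simp add: f_def\<close>)
    then obtain i where i: "t \<in> E (k i)" ..
    then show ?thesis using f_on[OF that(1) i] M by (intro exI[of _ i]) simp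
  qed
  have "modular f \<le> (\<Sum>i. ennreal (M i powr p) * mass (E (k i)))"
    by (rule modular_le_suminf_mass) (rule f_off)
  also have "\<dots> \<le> (\<Sum>i. ennreal ((1/2) ^ i))"
  proof (intro suminf_le summableI)
    fix i
    (* Row 0 of the series consists of the untranslated sets because s 0 is the identity. *)
    have "mass (E (k i)) = u 0 (k i)"
      using k(2)[of i] sG by (simp add: u_def s0 E_def)
    also have "\<dots> \<le> (\<Sum>n. u n (k i))"
      using sum_le_suminf[of "\<lambda>n. u n (k i)" "{0}"] by simp
    finally show "ennreal (M i powr p) * mass (E (k i)) \<le> ennreal ((1/2) ^ i)"
      using k(3)[of i] by (meson mult_left_mono order_trans zero_le)
  qed
  also note geo
  finally have f_Lp: "f \<in> weighted_Lp \<mu> p \<omega>"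
    unfolding weighted_Lp_iff by (simp add: f_def)
  have error: "modular (\<lambda>t. left_translation G (s (k j)) f t - g j t)
      \<le> (\<Sum>i. ennreal (M i powr p) * u (k j) (k i))" for j
  proof -
    let ?E = "\<lambda>i. if i = j then {} else (s (k j) \<otimes> inv (s (k i))) <# F (k i)"
    have "modular (\<lambda>t. left_translation G (s (k j)) f t - g j t)
        \<le> (\<Sum>i. ennreal (M i powr p) * mass (?E i))"
    proof (rule modular_le_suminf_mass)
      fix t assume t: "t \<in> carrier G" and ne: "left_translation G (s (k j)) f t - g j t \<noteq> 0"
      define x where "x = inv (s (k j)) \<otimes> t"
      have x: "x \<in> carrier G" "s (k j) \<otimes> x = t"
        using t sG by (auto simp: x_def simp flip: m_assoc)
      have Tf: "left_translation G (s (k j)) f t = f x"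
        using t by (simp add: left_translation_def x_def)
      have xj: "x \<notin> E (k j)" using ne f_on[OF x(1), of j] by (auto simp: Tf x)
      then have gj: "g j t = 0" using g_supp[of j t] E_iff[OF x(1), of "k j"] by (auto simp: x)
      then obtain i where i: "x \<in> E (k i)" "norm (f x) \<le> M i"
        using f_off[OF x(1)] ne by (auto simp: Tf)
      have "i \<noteq> j" using i xj by auto
      moreover have "t \<in> s (k j) <# E (k i)" using i x by (auto simp: l_coset_def)
      then have "t \<in> (s (k j) \<otimes> inv (s (k i))) <# F (k i)"
        unfolding E_def using sG F by (simp add: l_coset_assoc)
      ultimately show "\<exists>i. t \<in> ?E i \<and> norm (left_translation G (s (k j)) f t - g j t) \<le> M i"
        using i by (intro exI[of _ i]) (simp add: Tf gj)
    qed
    also have "(\<lambda>i. mass (?E i)) = (\<lambda>i. u (k j) (k i))"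
      using k_inj by (auto simp: u_def mass_def inj_eq)
    finally show ?thesis .
  qed
  have "(\<Sum>j. \<Sum>i. ennreal (M i powr p) * u (k j) (k i))
      = (\<Sum>i. \<Sum>j. ennreal (M i powr p) * u (k j) (k i))"
    by (rule double_suminf_ennreal_swap)
  also have "\<dots> \<le> (\<Sum>i. ennreal ((1/2) ^ i))"
  proof (intro suminf_le summableI)
    fix i
    have "(\<Sum>j. u (k j) (k i)) \<le> (\<Sum>n. u n (k i))"
      using suminf_ennreal_subseq_le[OF k_inj, of "\<lambda>n. u n (k i)"] .
    then show "(\<Sum>j. ennreal (M i powr p) * u (k j) (k i)) \<le> ennreal ((1/2) ^ i)"
      using k(3)[of i] unfolding ennreal_suminf_cmult by (meson mult_left_mono order_trans zero_le)
  qed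
  also note geo
  finally have "(\<lambda>j. \<Sum>i. ennreal (M i powr p) * u (k j) (k i)) \<longlonglongrightarrow> 0"
    by (rule suminf_ennreal_finite_imp_LIMSEQ_zero)
  then have "(\<lambda>j. modular (\<lambda>t. left_translation G (s (k j)) f t - g j t)) \<longlonglongrightarrow> 0"
    by (rule tendsto_sandwich[rotated 3, OF _ always_eventually always_eventually tendsto_const])
       (auto intro: error)
  moreover have "s (k j) \<in> S" for j using k(2)[of j] by (intro sS) auto
  ultimately show ?thesis using f_Lp by (intro bexI[of _ f] exI[of _ "\<lambda>j. s (k j)"]) auto
qed

text \<open>
  Each approximant is repeated infinitely often in the enumeration, so a single one can be matched at an
  index so large that the error of the orbit is already small.
\<close>
lemma summable_packings_imp_dense_vector:
  assumes S: "S \<subseteq> carrier G"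
    and packing: "admits_summable_packings S"
  obtains f where "dense_vector G \<mu> p S \<omega> f"
proof -
  obtain Q :: "complex set" where Q: "countable Q"
    "\<And>X. open X \<Longrightarrow> X \<noteq> {} \<Longrightarrow> \<exists>q\<in>Q. q \<in> X"
    by (rule countable_dense_setE) blast
  let ?D = "finsupp_funs Q"
  have "(\<lambda>_. 0) \<in> ?D" by (simp add: finsupp_funs_def)
  then have D: "countable ?D" "?D \<noteq> {}"
    using countable_finsupp_funs[OF Q(1)] by blast+
  define g where "g i = from_nat_into ?D (fst (prod_decode i))" for i
  have gD: "g i \<in> ?D" for i using from_nat_into[OF D(2)] by (simp add: g_def)
  have g_fin: "finite {t. g i t \<noteq> 0}" "{t. g i t \<noteq> 0} \<subseteq> carrier G" for i
    using gD[of i] by (auto simp: finsupp_funs_def)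
  obtain f r where f: "f \<in> weighted_Lp \<mu> p \<omega>" "\<And>j. r j \<in> S"
    "(\<lambda>j. modular (\<lambda>t. left_translation G (r j) f t - g j t)) \<longlonglongrightarrow> 0"
    using summable_packings_imp_approximating_orbit[of S g, OF S packing g_fin] by auto
  have "dense_vector G \<mu> p S \<omega> f"
    unfolding dense_vector_def
  proof (intro conjI ballI allI impI f(1))
    fix h and \<epsilon> :: real assume h: "h \<in> weighted_Lp \<mu> p \<omega>" and e: "0 < \<epsilon>"
    define \<eta> where "\<eta> = \<epsilon> powr p / (2 powr p * 2)"
    have eta: "0 < ennreal \<eta>" using e by (simp add: \<eta>_def)
    have "modular h < \<infinity>" using h by (simp add: weighted_Lp_iff)
    from finsupp_approx[OF Q(2) this eta]
    obtain d where d: "d \<in> ?D" "modular (\<lambda>t. h t - d t) < ennreal \<eta>" by blast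
    obtain N where N: "\<And>j. N \<le> j \<Longrightarrow>
        modular (\<lambda>t. left_translation G (r j) f t - g j t) < ennreal \<eta>"
      using order_tendstoD(2)[OF f(3) eta] unfolding eventually_sequentially by blast
    obtain m where m: "from_nat_into ?D m = d"
      using from_nat_into_surj[OF D(1) d(1)] by blast
    define j where "j = prod_encode (m, N)"
    have gj: "g j = d" by (simp add: g_def j_def m)
    have "N \<le> j" unfolding j_def by (rule le_prod_encode_2)
    then have 1: "modular (\<lambda>t. left_translation G (r j) f t - d t) < ennreal \<eta>"
      using N gj by metis
    have 2: "modular (\<lambda>t. d t - h t) < ennreal \<eta>"
      using d(2) by (simp add: modular_def norm_mult norm_minus_commute)
    have "modular (\<lambda>t. left_translation G (r j) f t - h t)
        \<le> ennreal (2 powr p) * (modular (\<lambda>t. left_translation G (r j) f t - d t)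
            + modular (\<lambda>t. d t - h t))"
      using modular_add_le[of "\<lambda>t. left_translation G (r j) f t - d t" "\<lambda>t. d t - h t"] by simp
    also have "\<dots> < ennreal (2 powr p) * (ennreal \<eta> + ennreal \<eta>)"
      using 1 2 by (intro ennreal_mult_strict_left_mono add_strict_mono) auto
    also have "\<dots> = ennreal (\<epsilon> powr p)"
      using e by (simp add: \<eta>_def field_simps flip: ennreal_plus ennreal_mult)
    finally have "weighted_Lp_norm \<mu> p \<omega> (\<lambda>t. left_translation G (r j) f t - h t) < \<epsilon>"
      by (rule weighted_Lp_norm_lessI[OF e])
    then show "\<exists>s\<in>S. weighted_Lp_norm \<mu> p \<omega> (\<lambda>t. left_translation G s f t - h t) < \<epsilon>"
      using f(2) by blast
  qed
  then show thesis by (rule that)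
qed

end

theorem corollary6:
  fixes G :: "('a, 'b) monoid_scheme" (structure)
    and \<mu> :: "'a measure" and p :: real and S :: "'a set" and \<omega> :: "'a \<Rightarrow> real"
  assumes "group G" and "countable (carrier G)" and "infinite (carrier G)"
    and "discrete_haar_measure G \<mu>"
    and "1 \<le> p"
    and "S \<subseteq> carrier G"
    and "admissible_weight G \<mu> p S \<omega>"
  shows "(\<exists>f. dense_vector G \<mu> p S \<omega> f) \<longleftrightarrow>
    (\<forall>F :: nat \<Rightarrow> 'a set.
       F 0 = {} \<and> (\<forall>n\<ge>1. finite (F n) \<and> F n \<subseteq> carrier G \<and> F n \<subseteq> F (Suc n)) \<longrightarrow>
       (\<exists>s :: nat \<Rightarrow> 'a.
          s 0 = \<one> \<and> (\<forall>n\<ge>1. s n \<in> S) \<and>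
          disjoint_family_on (\<lambda>n. inv (s n) <# F n) {1..} \<and>
          (\<Sum>\<^sub>\<infinity>(n, k)\<in>{(n, k). n \<noteq> k}.
             \<integral>\<^sup>+t\<in>((s n \<otimes> inv (s k)) <# F k). ennreal (\<omega> t powr p) \<partial>\<mu>) < \<infinity>))"
proof -
  interpret weighted_discrete_group G \<mu> p \<omega>
    using assms by (simp add: weighted_discrete_group_def weighted_discrete_group_axioms_def
        admissible_weight_def)
  have "(\<exists>f. dense_vector G \<mu> p S \<omega> f) \<longleftrightarrow> admits_summable_packings S"
    using dense_vector_imp_admits_summable_packings[OF assms(7,6)]
      summable_packings_imp_dense_vector[OF assms(6)] by blast
  then show ?thesis
    by (simp only: admits_summable_packings_def summable_packing_def mass_def)
qed
end
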